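(* Let $\mathrm{C} \in \{\text{Regular}, \text{CF}, \text{CS}, \text{RE}\}$. The class of epiC groups is closed under passage to finite index subgroups and to finite index overgroups. That is, if $G$ is a group and $H\leq G$ is a subgroup of finite index, then: if $G$ is epiC then $H$ is epiC, and if $H$ is epiC then $G$ is epiC.
   Context: For a set $X$, $X^*$ denotes the set of all finite strings over $X$, including the empty string. The language classes are the standard Chomsky classes: Regular (accepted by a finite state automaton), CF = context-free (accepted by a pushdown automaton), CS = context-sensitive (accepted by a linearly bounded automaton), RE = recursively enumerable (accepted by a Turing machine). For a group $G$ and $X\subseteq G$, and $w\in X^*$, $g\in G$, write $w=_G g$ if the product in $G$ of the letters of $w$ equals $g$. A group $G$ is epiC if there are a finite set $X\subseteq G$ generating $G$ as a monoid and a language $L\subseteq X^*$ in the class C such that no $w\in L$ satisfies $w=_G 1_G$, and for every $h\in G\setminus\{1_G\}$ there is $w_h\in L$ with $w_h=_G h$. *)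

theory Defs
  imports "HOL-Algebra.Coset"
begin

section \<open>Finite state automata\<close>

record 'a fsa =
  fsa_states :: "nat set"
  fsa_init :: nat
  fsa_final :: "nat set"
  fsa_trans :: "(nat \<times> 'a \<times> nat) set"

definition wf_fsa :: "'a set \<Rightarrow> 'a fsa \<Rightarrow> bool" where
  "wf_fsa A M \<longleftrightarrow>
     finite (fsa_states M) \<and> fsa_init M \<in> fsa_states M \<and> fsa_final M \<subseteq> fsa_states M \<and>
     fsa_trans M \<subseteq> fsa_states M \<times> A \<times> fsa_states M"

inductive fsa_run :: "'a fsa \<Rightarrow> nat \<Rightarrow> 'a list \<Rightarrow> nat \<Rightarrow> bool" for M where
  fsa_run_Nil: "fsa_run M q [] q"
| fsa_run_Cons: "(q, a, p) \<in> fsa_trans M \<Longrightarrow> fsa_run M p w r \<Longrightarrow> fsa_run M q (a # w) r"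

definition fsa_language :: "'a fsa \<Rightarrow> 'a list set" where
  "fsa_language M = {w. \<exists>f\<in>fsa_final M. fsa_run M (fsa_init M) w f}"


section \<open>Pushdown automata\<close>

text \<open>
  A transition \<open>(q, x, Z, p, \<gamma>)\<close> goes from state \<open>q\<close> to state \<open>p\<close>, replacing the top stack
  symbol \<open>Z\<close> by the string \<open>\<gamma>\<close>; it consumes the letter \<open>a\<close> if \<open>x = Some a\<close> and no input if
  \<open>x = None\<close>. The head of a list is the top of the stack. Acceptance is by final state.
\<close>

record 'a pda =
  pda_states :: "nat set"
  pda_stack :: "nat set"
  pda_init :: nat
  pda_bottom :: nat
  pda_final :: "nat set"
  pda_trans :: "(nat \<times> 'a option \<times> nat \<times> nat \<times> nat list) set"

definition wf_pda :: "'a set \<Rightarrow> 'a pda \<Rightarrow> bool" where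
  "wf_pda A M \<longleftrightarrow>
     finite (pda_states M) \<and> finite (pda_stack M) \<and> finite (pda_trans M) \<and>
     pda_init M \<in> pda_states M \<and> pda_bottom M \<in> pda_stack M \<and> pda_final M \<subseteq> pda_states M \<and>
     pda_trans M \<subseteq> pda_states M \<times> insert None (Some ` A) \<times> pda_stack M
                     \<times> pda_states M \<times> lists (pda_stack M)"

type_synonym 'a pda_config = "nat \<times> 'a list \<times> nat list"

inductive pda_step :: "'a pda \<Rightarrow> 'a pda_config \<Rightarrow> 'a pda_config \<Rightarrow> bool" for M where
  pda_step_read:
    "(q, Some a, Z, p, \<gamma>) \<in> pda_trans M \<Longrightarrow> pda_step M (q, a # w, Z # \<beta>) (p, w, \<gamma> @ \<beta>)"
| pda_step_silent:
    "(q, None, Z, p, \<gamma>) \<in> pda_trans M \<Longrightarrow> pda_step M (q, w, Z # \<beta>) (p, w, \<gamma> @ \<beta>)"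

definition pda_language :: "'a pda \<Rightarrow> 'a list set" where
  "pda_language M =
     {w. \<exists>f\<in>pda_final M. \<exists>\<beta>. (pda_step M)\<^sup>*\<^sup>* (pda_init M, w, [pda_bottom M]) (f, [], \<beta>)}"


section \<open>Turing machines and linearly bounded automata\<close>

datatype 'a tape_sym = Inp 'a | Blank | LEnd | REnd | Work nat

datatype move = MoveLeft | Stay | MoveRight

fun move_offset :: "move \<Rightarrow> int" where
  "move_offset MoveLeft = - 1"
| "move_offset Stay = 0"
| "move_offset MoveRight = 1"

text \<open>
  Machines are nondeterministic, with one two-way infinite tape. A transition \<open>(q, s, p, t, d)\<close>
  is applicable in state \<open>q\<close> when \<open>s\<close> is scanned; it overwrites \<open>s\<close> by \<open>t\<close>, moves the head
  according to \<open>d\<close> and enters state \<open>p\<close>. An input is accepted if some computation reaches a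
  final state.
\<close>

record 'a tm =
  tm_states :: "nat set"
  tm_syms :: "'a tape_sym set"
  tm_init :: nat
  tm_final :: "nat set"
  tm_trans :: "(nat \<times> 'a tape_sym \<times> nat \<times> 'a tape_sym \<times> move) set"

definition wf_tm :: "'a set \<Rightarrow> 'a tm \<Rightarrow> bool" where
  "wf_tm A M \<longleftrightarrow>
     finite (tm_states M) \<and> finite (tm_syms M) \<and> Inp ` A \<subseteq> tm_syms M \<and> Blank \<in> tm_syms M \<and>
     tm_init M \<in> tm_states M \<and> tm_final M \<subseteq> tm_states M \<and>
     tm_trans M \<subseteq> tm_states M \<times> tm_syms M \<times> tm_states M \<times> tm_syms M \<times> UNIV"

type_synonym 'a tm_config = "nat \<times> (int \<Rightarrow> 'a tape_sym) \<times> int"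

inductive tm_step :: "'a tm \<Rightarrow> 'a tm_config \<Rightarrow> 'a tm_config \<Rightarrow> bool" for M where
  "(q, T i, p, t, d) \<in> tm_trans M \<Longrightarrow> tm_step M (q, T, i) (p, T(i := t), i + move_offset d)"

definition tape_of :: "'a tape_sym list \<Rightarrow> int \<Rightarrow> 'a tape_sym" where
  "tape_of s i = (if 0 \<le> i \<and> i < int (length s) then s ! nat i else Blank)"

definition tm_accepts :: "'a tm \<Rightarrow> 'a tape_sym list \<Rightarrow> bool" where
  "tm_accepts M s \<longleftrightarrow>
     (\<exists>f\<in>tm_final M. \<exists>T i. (tm_step M)\<^sup>*\<^sup>* (tm_init M, tape_of s, 0) (f, T, i))"

definition tm_language :: "'a set \<Rightarrow> 'a tm \<Rightarrow> 'a list set" where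
  "tm_language A M = {w \<in> lists A. tm_accepts M (map Inp w)}"

text \<open>
  A linearly bounded automaton is started on its input enclosed by end markers. It can neither
  overwrite an end marker nor move beyond it, so the head never leaves the tape segment that is
  initially occupied by the input and the two markers.
\<close>

definition wf_lba :: "'a set \<Rightarrow> 'a tm \<Rightarrow> bool" where
  "wf_lba A M \<longleftrightarrow>
     wf_tm A M \<and> LEnd \<in> tm_syms M \<and> REnd \<in> tm_syms M \<and>
     (\<forall>q p t d. (q, LEnd, p, t, d) \<in> tm_trans M \<longrightarrow> t = LEnd \<and> d \<noteq> MoveLeft) \<and>
     (\<forall>q p t d. (q, REnd, p, t, d) \<in> tm_trans M \<longrightarrow> t = REnd \<and> d \<noteq> MoveRight)"

definition lba_language :: "'a set \<Rightarrow> 'a tm \<Rightarrow> 'a list set" where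
  "lba_language A M = {w \<in> lists A. tm_accepts M (LEnd # map Inp w @ [REnd])}"


section \<open>The Chomsky classes\<close>

datatype chomsky_class = Regular | CF | CS | RE

text \<open>\<open>in_class C A L\<close>: \<open>L\<close> is a language over the alphabet \<open>A\<close> that belongs to the class \<open>C\<close>.\<close>

fun in_class :: "chomsky_class \<Rightarrow> 'a set \<Rightarrow> 'a list set \<Rightarrow> bool" where
  "in_class Regular A L \<longleftrightarrow> (\<exists>M. wf_fsa A M \<and> L = fsa_language M)"
| "in_class CF A L \<longleftrightarrow> (\<exists>M. wf_pda A M \<and> L = pda_language M)"
| "in_class CS A L \<longleftrightarrow> (\<exists>M. wf_lba A M \<and> L = lba_language A M)"
| "in_class RE A L \<longleftrightarrow> (\<exists>M. wf_tm A M \<and> L = tm_language A M)"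


section \<open>EpiC groups\<close>

definition word_value :: "('a, 'b) monoid_scheme \<Rightarrow> 'a list \<Rightarrow> 'a" where
  "word_value G w = foldr (\<otimes>\<^bsub>G\<^esub>) w \<one>\<^bsub>G\<^esub>"

definition generates_as_monoid :: "('a, 'b) monoid_scheme \<Rightarrow> 'a set \<Rightarrow> bool" where
  "generates_as_monoid G X \<longleftrightarrow>
     X \<subseteq> carrier G \<and> (\<forall>g\<in>carrier G. \<exists>w\<in>lists X. word_value G w = g)"

definition epi_group :: "chomsky_class \<Rightarrow> ('a, 'b) monoid_scheme \<Rightarrow> bool" where
  "epi_group C G \<longleftrightarrow>
     (\<exists>X L. finite X \<and> generates_as_monoid G X \<and>
        L \<subseteq> lists X \<and> in_class C X L \<and>
        (\<forall>w\<in>L. word_value G w \<noteq> \<one>\<^bsub>G\<^esub>) \<and>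
        (\<forall>h\<in>carrier G - {\<one>\<^bsub>G\<^esub>}. \<exists>w\<in>L. word_value G w = h))"

end

theory Submission
  imports Defs "HOL-Library.Countable"
begin

text \<open>
  Both directions replace the given language by its image under a finite letter-to-letter
  transducer, a nondeterministic automaton that reads one letter and writes one letter in each
  step. Such a transduction preserves the length of words, so that every one of the four classes,
  the context-sensitive languages included, is closed under it (\<open>in_class_transduction\<close>).

  Subgroups (\<open>epi_group_subgroup\<close>). Let \<open>T\<close> be a right transversal of \<open>H\<close> that contains \<open>1\<close>. The
  Reidemeister--Schreier rewriting process reads a word \<open>x\<^sub>1 \<dots> x\<^sub>n\<close> from left to right, remembers the
  representative \<open>t\<^sub>i\<close> of the coset of \<open>x\<^sub>1 \<dots> x\<^sub>i\<close>, and replaces \<open>x\<^sub>i\<close> by the element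
  \<open>t\<^sub>i\<^sub>-\<^sub>1 x\<^sub>i t\<^sub>i\<^sup>-\<^sup>1\<close> of \<open>H\<close>. It is a letter-to-letter transduction with state set \<open>T\<close>. Runs that
  start and end in \<open>1\<close> are the runs on words with value in \<open>H\<close>, and they preserve the value.

  Overgroups (\<open>epi_group_overgroup\<close>). An element of \<open>G\<close> is a product \<open>h t\<close> with \<open>h \<in> H\<close> and
  \<open>t \<in> T\<close>. A word for \<open>h\<close> becomes a word of the same length for \<open>h t\<close> when its last letter \<open>x\<close> is
  replaced by the single letter \<open>x t\<close>. This misses the elements \<open>t \<noteq> 1\<close>, since the language
  has no word of value \<open>1\<close>. They are recovered from a fixed \<open>k \<noteq> 1\<close> in \<open>H\<close> as
  \<open>t = k\<^sup>-\<^sup>1 (k t)\<close>, by also allowing the letters \<open>x (k t)\<close>. If \<open>H\<close> is trivial, there is no such \<open>k\<close>,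
  but then \<open>G\<close> is finite and its nontrivial elements form a suitable language of one-letter words.
\<close>


section \<open>Letter-to-letter transductions\<close>

inductive transduces :: "('s \<times> 'a \<times> 'b \<times> 's) set \<Rightarrow> 's \<Rightarrow> 'a list \<Rightarrow> 'b list \<Rightarrow> 's \<Rightarrow> bool"
  for \<Delta> where
  transduces_Nil: "transduces \<Delta> p [] [] p"
| transduces_Cons: "(p, a, b, q) \<in> \<Delta> \<Longrightarrow> transduces \<Delta> q u v r \<Longrightarrow> transduces \<Delta> p (a # u) (b # v) r"

inductive_cases transduces_Nil1E: "transduces \<Delta> p [] v q"
inductive_cases transduces_Cons1E: "transduces \<Delta> p (a # u) v q"

definition transduction :: "('s \<times> 'a \<times> 'b \<times> 's) set \<Rightarrow> 's \<Rightarrow> 's set \<Rightarrow> 'a list set \<Rightarrow> 'b list set" where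
  "transduction \<Delta> p F L = {v. \<exists>u\<in>L. \<exists>q\<in>F. transduces \<Delta> p u v q}"

lemma transduces_snoc:
  assumes "transduces \<Delta> p u v q" and "(q, a, b, r) \<in> \<Delta>"
  shows "transduces \<Delta> p (u @ [a]) (v @ [b]) r"
  using assms by induction (auto intro: transduces.intros)

locale letter_transducer =
  fixes Q :: "nat set" and A B :: "'a set" and \<Delta> :: "(nat \<times> 'a \<times> 'a \<times> nat) set"
    and p0 :: nat and F :: "nat set"
  assumes finite_Q: "finite Q" and finite_A: "finite A" and finite_B: "finite B"
    and \<Delta>_subset: "\<Delta> \<subseteq> Q \<times> A \<times> B \<times> Q" and p0_in: "p0 \<in> Q" and F_subset: "F \<subseteq> Q"
begin

lemma transduces_lists: "transduces \<Delta> p u v q \<Longrightarrow> u \<in> lists A \<and> v \<in> lists B"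
  by (induction rule: transduces.induct) (use \<Delta>_subset in auto)

lemma transduction_subset: "transduction \<Delta> p0 F L \<subseteq> lists B"
  using transduces_lists by (fastforce simp: transduction_def)

lemma finite_\<Delta>: "finite \<Delta>"
  using \<Delta>_subset by (rule finite_subset) (simp add: finite_Q finite_A finite_B)

end


section \<open>Regular and context-free languages\<close>

context letter_transducer
begin

text \<open>
  The product automaton reads the output of the transducer and guesses a matching input, which it
  feeds into \<open>M\<close>. Its states are pairs, encoded as numbers.
\<close>
definition fsa_product :: "'a fsa \<Rightarrow> 'a fsa" where
  "fsa_product M = \<lparr>fsa_states = to_nat ` (fsa_states M \<times> Q), fsa_init = to_nat (fsa_init M, p0),
     fsa_final = to_nat ` (fsa_final M \<times> F),
     fsa_trans = {(to_nat (q, p), b, to_nat (q', p')) | q p b q' p'.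
       \<exists>a. (q, a, q') \<in> fsa_trans M \<and> (p, a, b, p') \<in> \<Delta>}\<rparr>"

lemma wf_fsa_product: "wf_fsa A M \<Longrightarrow> wf_fsa B (fsa_product M)"
  using \<Delta>_subset p0_in F_subset finite_Q
  unfolding wf_fsa_def fsa_product_def by (auto 0 3)

lemma fsa_run_product:
  "fsa_run (fsa_product M) (to_nat (q, p)) v (to_nat (q', p')) \<longleftrightarrow>
     (\<exists>u. fsa_run M q u q' \<and> transduces \<Delta> p u v p')"
proof
  assume "fsa_run (fsa_product M) (to_nat (q, p)) v (to_nat (q', p'))"
  then show "\<exists>u. fsa_run M q u q' \<and> transduces \<Delta> p u v p'"
  proof (induction "to_nat (q, p)" v "to_nat (q', p')" arbitrary: q p rule: fsa_run.induct)
    case fsa_run_Nil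
    then show ?case by (auto intro: fsa_run.intros transduces.intros)
  next
    case (fsa_run_Cons b s v)
    then obtain q1 p1 a where "s = to_nat (q1, p1)" "(q, a, q1) \<in> fsa_trans M" "(p, a, b, p1) \<in> \<Delta>"
      by (auto simp: fsa_product_def)
    moreover from this obtain u where "fsa_run M q1 u q'" "transduces \<Delta> p1 u v p'"
      using fsa_run_Cons.hyps(3) by blast
    ultimately show ?case
      by (blast intro: fsa_run.fsa_run_Cons transduces_Cons)
  qed
next
  have "transduces \<Delta> p u v p' \<Longrightarrow>
      fsa_run (fsa_product M) (to_nat (q, p)) v (to_nat (q', p'))" if "fsa_run M q u q'" for u
    using that
  proof (induction arbitrary: p v)
    case (fsa_run_Nil q)
    then show ?case by (auto elim: transduces_Nil1E intro: fsa_run.intros)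
  next
    case (fsa_run_Cons q a q1 u r)
    from fsa_run_Cons.prems obtain b v1 p1
      where "v = b # v1" "(p, a, b, p1) \<in> \<Delta>" "transduces \<Delta> p1 u v1 p'"
      by (auto elim: transduces_Cons1E)
    with fsa_run_Cons show ?case
      by (auto simp: fsa_product_def intro!: fsa_run.fsa_run_Cons[of _ _ "to_nat (q1, p1)"])
  qed
  then show "\<exists>u. fsa_run M q u q' \<and> transduces \<Delta> p u v p' \<Longrightarrow>
      fsa_run (fsa_product M) (to_nat (q, p)) v (to_nat (q', p'))"
    by blast
qed

lemma fsa_language_product: "fsa_language (fsa_product M) = transduction \<Delta> p0 F (fsa_language M)"
proof -
  have "v \<in> fsa_language (fsa_product M) \<longleftrightarrow> (\<exists>f\<in>fsa_final M. \<exists>q\<in>F.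
      fsa_run (fsa_product M) (to_nat (fsa_init M, p0)) v (to_nat (f, q)))" for v
    by (auto simp: fsa_language_def fsa_product_def)
  then show ?thesis
    unfolding fsa_run_product by (auto simp: transduction_def fsa_language_def)
qed

text \<open>
  As for finite automata, with the stack of \<open>M\<close>. A silent move of \<open>M\<close> consumes no letter of the
  guessed input, so the transducer waits. Both parts of the transition set are written as images of
  finite sets, from which its finiteness can be read off.
\<close>
definition pda_product :: "'a pda \<Rightarrow> 'a pda" where
  "pda_product M = \<lparr>pda_states = to_nat ` (pda_states M \<times> Q), pda_stack = pda_stack M,
     pda_init = to_nat (pda_init M, p0), pda_bottom = pda_bottom M,
     pda_final = to_nat ` (pda_final M \<times> F),
     pda_trans =
       (\<lambda>((q, x, Z, q', \<gamma>), (p, a, b, p')). (to_nat (q, p), Some b, Z, to_nat (q', p'), \<gamma>)) `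
         {((q, x, Z, q', \<gamma>), (p, a, b, p')) | q x Z q' \<gamma> p a b p'.
            (q, x, Z, q', \<gamma>) \<in> pda_trans M \<and> (p, a, b, p') \<in> \<Delta> \<and> x = Some a} \<union>
       (\<lambda>((q, x, Z, q', \<gamma>), p). (to_nat (q, p), None, Z, to_nat (q', p), \<gamma>)) `
         ({t \<in> pda_trans M. fst (snd t) = None} \<times> Q)\<rparr>"

lemma pda_product_trans:
  "(s, x, Z, s', \<gamma>) \<in> pda_trans (pda_product M) \<longleftrightarrow>
     (\<exists>q p q' p' a b. s = to_nat (q, p) \<and> s' = to_nat (q', p') \<and> x = Some b \<and>
        (q, Some a, Z, q', \<gamma>) \<in> pda_trans M \<and> (p, a, b, p') \<in> \<Delta>) \<or>
     (\<exists>q q' p. s = to_nat (q, p) \<and> s' = to_nat (q', p) \<and> x = None \<and> p \<in> Q \<and>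
        (q, None, Z, q', \<gamma>) \<in> pda_trans M)"
  unfolding pda_product_def by (force simp: image_iff)

lemma wf_pda_product:
  assumes "wf_pda A M"
  shows "wf_pda B (pda_product M)"
proof -
  have "finite (pda_trans (pda_product M))"
    using assms finite_\<Delta> finite_Q unfolding pda_product_def wf_pda_def
    by (auto intro!: finite_imageI intro: finite_subset[of _ "pda_trans M \<times> \<Delta>"])
  moreover have "pda_trans (pda_product M) \<subseteq>
      to_nat ` (pda_states M \<times> Q) \<times> insert None (Some ` B) \<times> pda_stack M
        \<times> to_nat ` (pda_states M \<times> Q) \<times> lists (pda_stack M)"
    using assms \<Delta>_subset unfolding wf_pda_def
    by (fastforce simp only: pda_product_trans split_paired_all subset_iff mem_Sigma_iff)
  ultimately show ?thesis
    using assms finite_Q p0_in F_subset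
    by (auto simp: wf_pda_def pda_product_def)
qed

text \<open>
  The premise \<open>p \<in> Q\<close> is there because the product has silent moves for the states in \<open>Q\<close> only.
\<close>
lemma pda_product_complete:
  assumes "(pda_step M)\<^sup>*\<^sup>* (q, u, \<beta>) (f, [], \<beta>')" and "transduces \<Delta> p u v r" and "p \<in> Q"
  shows "(pda_step (pda_product M))\<^sup>*\<^sup>* (to_nat (q, p), v, \<beta>) (to_nat (f, r), [], \<beta>')"
  using assms
proof (induction "(q, u, \<beta>)" arbitrary: q u \<beta> p v rule: converse_rtranclp_induct)
  case base
  then show ?case by (auto elim: transduces_Nil1E)
next
  case (step c)
  from step.hyps(1) show ?case
  proof cases
    case (pda_step_read a Z q' \<gamma> w \<beta>1)
    then obtain b v1 p1 where v: "v = b # v1" "(p, a, b, p1) \<in> \<Delta>" "transduces \<Delta> p1 w v1 r"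
      using step.prems by (auto elim: transduces_Cons1E)
    then have "pda_step (pda_product M) (to_nat (q, p), v, \<beta>) (to_nat (q', p1), v1, \<gamma> @ \<beta>1)"
      using pda_step_read by (auto simp: pda_product_trans intro!: pda_step.intros)
    moreover have "p1 \<in> Q" using v \<Delta>_subset by auto
    ultimately show ?thesis
      using step.hyps(3)[OF _ v(3)] pda_step_read by (blast intro: converse_rtranclp_into_rtranclp)
  next
    case (pda_step_silent Z q' \<gamma> \<beta>1)
    then have "pda_step (pda_product M) (to_nat (q, p), v, \<beta>) (to_nat (q', p), v, \<gamma> @ \<beta>1)"
      using step.prems by (auto simp: pda_product_trans intro!: pda_step.intros)
    then show ?thesis
      using step.hyps(3)[OF _ step.prems] pda_step_silent
      by (blast intro: converse_rtranclp_into_rtranclp)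
  qed
qed

lemma pda_product_sound:
  assumes "(pda_step (pda_product M))\<^sup>*\<^sup>* (to_nat (q, p), v, \<beta>) (to_nat (f, r), [], \<beta>')"
  shows "\<exists>u. transduces \<Delta> p u v r \<and> (pda_step M)\<^sup>*\<^sup>* (q, u, \<beta>) (f, [], \<beta>')"
  using assms
proof (induction "(to_nat (q, p), v, \<beta>)" arbitrary: q p v \<beta> rule: converse_rtranclp_induct)
  case base
  then show ?case by (auto intro: transduces.intros)
next
  case (step c)
  from step.hyps(1) show ?case
  proof cases
    case (pda_step_read b Z s \<gamma> v1 \<beta>1)
    then obtain q' p' a where t: "s = to_nat (q', p')" "(q, Some a, Z, q', \<gamma>) \<in> pda_trans M"
        "(p, a, b, p') \<in> \<Delta>"
      by (auto simp: pda_product_trans)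
    then obtain u where "transduces \<Delta> p' u v1 r" "(pda_step M)\<^sup>*\<^sup>* (q', u, \<gamma> @ \<beta>1) (f, [], \<beta>')"
      using step.hyps(3) pda_step_read by blast
    then have "transduces \<Delta> p (a # u) v r" "(pda_step M)\<^sup>*\<^sup>* (q, a # u, \<beta>) (f, [], \<beta>')"
      using t pda_step_read
      by (auto intro: transduces_Cons converse_rtranclp_into_rtranclp pda_step.intros)
    then show ?thesis by blast
  next
    case (pda_step_silent Z s \<gamma> \<beta>1)
    then obtain q' where t: "s = to_nat (q', p)" "(q, None, Z, q', \<gamma>) \<in> pda_trans M"
      by (auto simp: pda_product_trans)
    then obtain u where "transduces \<Delta> p u v r" "(pda_step M)\<^sup>*\<^sup>* (q', u, \<gamma> @ \<beta>1) (f, [], \<beta>')"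
      using step.hyps(3) pda_step_silent by blast
    then have "transduces \<Delta> p u v r" "(pda_step M)\<^sup>*\<^sup>* (q, u, \<beta>) (f, [], \<beta>')"
      using t pda_step_silent
      by (auto intro: converse_rtranclp_into_rtranclp pda_step.intros)
    then show ?thesis by blast
  qed
qed

lemma pda_language_product: "pda_language (pda_product M) = transduction \<Delta> p0 F (pda_language M)"
proof -
  have "v \<in> pda_language (pda_product M) \<longleftrightarrow> (\<exists>f\<in>pda_final M. \<exists>q\<in>F. \<exists>\<beta>.
      (pda_step (pda_product M))\<^sup>*\<^sup>* (to_nat (pda_init M, p0), v, [pda_bottom M]) (to_nat (f, q), [], \<beta>))" for v
    by (auto simp: pda_language_def) (force simp: pda_product_def)+
  then show ?thesis
    unfolding transduction_def pda_language_def
    by (fast intro: pda_product_complete[OF _ _ p0_in] dest: pda_product_sound)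
qed

end


section \<open>Context-sensitive and recursively enumerable languages\<close>

text \<open>
  A machine for the transduced language overwrites its input \<open>v\<close>, letter by letter, by a guessed
  word \<open>w\<close> that the transducer maps to \<open>v\<close> (phase \<open>Scan\<close>, which carries the state of the
  transducer). It then returns to the left end (\<open>Back\<close>) and simulates \<open>M\<close> on \<open>w\<close> (\<open>Run\<close>). Since
  \<open>w\<close> has the length of \<open>v\<close>, the tape is then exactly an initial tape of \<open>M\<close>, and a linearly
  bounded automaton never needs to move its end markers. \<open>Start\<close> steps from the left end marker to
  the first letter.
\<close>
datatype phase = Start | Scan nat | Back | Run nat

instance phase :: countable
  by countable_datatype

lemma tape_of_nth [simp]: "tape_of (xs @ s # ys) (int (length xs)) = s"
  by (simp add: tape_of_def)

lemma tape_of_upd: "(tape_of (xs @ s # ys))(int (length xs) := t) = tape_of (xs @ t # ys)"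
  by (rule ext) (auto simp: tape_of_def nth_append nth_Cons' nat_eq_iff)

text \<open>
  Turing machines and linearly bounded automata are treated together. The input is framed by \<open>pre\<close>
  and \<open>post\<close>, which are empty or consist of an end marker. In either case some non-input symbols
  \<open>lm\<close> and \<open>rm\<close> stand next to the input; for Turing machines they are blanks. The head returns to
  \<open>lm\<close>, and the move \<open>d\<close> takes it from there to position \<open>0\<close>, where \<open>M\<close> expects it: a Turing
  machine has to leave the blank at position \<open>-1\<close>, a linearly bounded automaton stays on its marker.
\<close>
locale guessing_machine = letter_transducer Q A B \<Delta> p0 F
  for Q A and B :: "'a set" and \<Delta> p0 F +
  fixes M :: "'a tm" and pre post :: "'a tape_sym list" and lm rm :: "'a tape_sym" and d :: move
    and start :: phase
  assumes left_marker: "\<And>w. tape_of (pre @ map Inp w @ post) (int (length pre) - 1) = lm"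
    and right_marker: "\<And>w. tape_of (pre @ map Inp w @ post) (int (length pre) + int (length w)) = rm"
    and markers_not_Inp: "lm \<notin> range Inp" "rm \<notin> range Inp"
    and head_start: "int (length pre) - 1 + move_offset d = 0"
    and start: "start = Start \<and> length pre = 1 \<or> start = Scan p0 \<and> length pre = 0"
begin

definition tape :: "'a list \<Rightarrow> int \<Rightarrow> 'a tape_sym" where
  "tape w = tape_of (pre @ map Inp w @ post)"

inductive_set guess_trans :: "(nat \<times> 'a tape_sym \<times> nat \<times> 'a tape_sym \<times> move) set" where
  enter: "(to_nat Start, lm, to_nat (Scan p0), lm, MoveRight) \<in> guess_trans"
| guess: "(p, a, b, p') \<in> \<Delta> \<Longrightarrow>
    (to_nat (Scan p), Inp b, to_nat (Scan p'), Inp a, MoveRight) \<in> guess_trans"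
| turn: "p \<in> F \<Longrightarrow> (to_nat (Scan p), rm, to_nat Back, rm, MoveLeft) \<in> guess_trans"
| retreat: "a \<in> A \<Longrightarrow> (to_nat Back, Inp a, to_nat Back, Inp a, MoveLeft) \<in> guess_trans"
| launch: "(to_nat Back, lm, to_nat (Run (tm_init M)), lm, d) \<in> guess_trans"
| run: "(q, s, q', t, e) \<in> tm_trans M \<Longrightarrow>
    (to_nat (Run q), s, to_nat (Run q'), t, e) \<in> guess_trans"

definition guess_tm :: "'a tm" where
  "guess_tm = \<lparr>tm_states = to_nat ` ({Start, Back} \<union> Scan ` Q \<union> Run ` tm_states M),
     tm_syms = tm_syms M \<union> Inp ` B, tm_init = to_nat start,
     tm_final = (\<lambda>q. to_nat (Run q)) ` tm_final M, tm_trans = guess_trans\<rparr>"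

lemma wf_guess_tm:
  assumes "wf_tm A M" and "lm \<in> tm_syms M" and "rm \<in> tm_syms M"
  shows "wf_tm B guess_tm"
proof -
  have "q \<in> tm_states guess_tm \<and> s \<in> tm_syms guess_tm \<and> p \<in> tm_states guess_tm \<and> t \<in> tm_syms guess_tm"
    if "(q, s, p, t, e) \<in> guess_trans" for q s p t e
    using that
    by cases (use assms \<Delta>_subset p0_in F_subset in \<open>auto simp: guess_tm_def wf_tm_def intro!: imageI\<close>)
  then have "guess_trans \<subseteq> tm_states guess_tm \<times> tm_syms guess_tm \<times> tm_states guess_tm \<times>
      tm_syms guess_tm \<times> UNIV"
    by auto
  then show ?thesis
    using assms start p0_in finite_B finite_Q by (auto simp: guess_tm_def wf_tm_def)
qed

lemma guess_step:
  "(s, T i, s', t, e) \<in> guess_trans \<Longrightarrow> T' = T(i := t) \<Longrightarrow> i' = i + move_offset e \<Longrightarrow>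
     tm_step guess_tm (s, T, i) (s', T', i')"
  using tm_step.intros[of s T i s' t e guess_tm] by (simp add: guess_tm_def)

lemma guess_trans_Start:
  "(to_nat Start, s, r, t, e) \<in> guess_trans \<Longrightarrow>
     s = lm \<and> r = to_nat (Scan p0) \<and> t = lm \<and> e = MoveRight"
  by (erule guess_trans.cases) auto

lemma guess_trans_Scan:
  "(to_nat (Scan p), s, r, t, e) \<in> guess_trans \<Longrightarrow>
     (\<exists>a b p'. (p, a, b, p') \<in> \<Delta> \<and> s = Inp b \<and> r = to_nat (Scan p') \<and> t = Inp a \<and> e = MoveRight) \<or>
     p \<in> F \<and> s = rm \<and> r = to_nat Back \<and> t = rm \<and> e = MoveLeft"
  by (erule guess_trans.cases) auto

lemma guess_trans_Back:
  "(to_nat Back, s, r, t, e) \<in> guess_trans \<Longrightarrow>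
     s \<in> range Inp \<and> r = to_nat Back \<and> t = s \<and> e = MoveLeft \<or>
     s = lm \<and> r = to_nat (Run (tm_init M)) \<and> t = lm \<and> e = d"
  by (erule guess_trans.cases) auto

lemma guess_trans_Run:
  "(to_nat (Run q), s, r, t, e) \<in> guess_trans \<Longrightarrow>
     \<exists>q'. r = to_nat (Run q') \<and> (q, s, q', t, e) \<in> tm_trans M"
  by (erule guess_trans.cases) auto

lemma tape_read [simp]: "tape (u @ b # w) (int (length pre) + int (length u)) = Inp b"
  using tape_of_nth[of "pre @ map Inp u" "Inp b" "map Inp w @ post"] by (simp add: tape_def)

lemma tape_write: "(tape (u @ b # w))(int (length pre) + int (length u) := Inp a) = tape (u @ a # w)"
  using tape_of_upd[of "pre @ map Inp u" "Inp b" "map Inp w @ post" "Inp a"] by (simp add: tape_def)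

lemma tape_left [simp]: "tape w (int (length pre) - 1) = lm"
  by (simp add: tape_def left_marker)

lemma tape_right [simp]: "tape w (int (length pre) + int (length w)) = rm"
  using right_marker by (simp add: tape_def)

text \<open>
  An invariant of the computations on input \<open>v\<close>. In phase \<open>Scan\<close> the tape holds the part \<open>u\<close>
  that has been guessed, followed by the unread rest of \<open>v\<close>; from phase \<open>Back\<close> on, a complete
  preimage of \<open>v\<close> has been fixed. In phase \<open>Back\<close> the head is on the last letter of \<open>w1\<close>, or on the left
  marker if \<open>w1\<close> is empty.
\<close>
inductive reachable :: "'a list \<Rightarrow> 'a tm_config \<Rightarrow> bool" for v where
  at_Start: "reachable v (to_nat Start, tape v, int (length pre) - 1)"
| at_Scan: "transduces \<Delta> p0 u v1 p \<Longrightarrow> v = v1 @ v2 \<Longrightarrow>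
    reachable v (to_nat (Scan p), tape (u @ v2), int (length pre) + int (length u))"
| at_Back: "transduces \<Delta> p0 (w1 @ w2) v q \<Longrightarrow> q \<in> F \<Longrightarrow>
    reachable v (to_nat Back, tape (w1 @ w2), int (length pre) + int (length w1) - 1)"
| at_Run: "transduces \<Delta> p0 w v q \<Longrightarrow> q \<in> F \<Longrightarrow>
    (tm_step M)\<^sup>*\<^sup>* (tm_init M, tape w, 0) (q', T, i) \<Longrightarrow> reachable v (to_nat (Run q'), T, i)"

lemma reachable_step:
  assumes "reachable v c" and "tm_step guess_tm c c'"
  shows "reachable v c'"
proof -
  obtain s T i s' t e where c: "c = (s, T, i)" and c': "c' = (s', T(i := t), i + move_offset e)"
    and tr: "(s, T i, s', t, e) \<in> guess_trans"
    using assms(2) by (auto elim!: tm_step.cases simp: guess_tm_def)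
  from assms(1) show ?thesis
  proof cases
    case at_Start
    with c tr have "s' = to_nat (Scan p0)" "t = lm" "e = MoveRight"
      using guess_trans_Start[of "T i" s' t e] by auto
    with at_Start c c' show ?thesis
      using reachable.at_Scan[OF transduces_Nil, of v v] by (simp add: fun_upd_idem)
  next
    case (at_Scan u v1 p v2)
    show ?thesis
    proof (cases v2)
      case Nil
      then have "T i = rm" using c at_Scan tape_right[of u] by auto
      then have "s' = to_nat Back" "t = rm" "e = MoveLeft" "p \<in> F"
        using guess_trans_Scan[of p "T i" s' t e] tr c at_Scan markers_not_Inp by auto
      then show ?thesis
        using reachable.at_Back[of u "[]" v p] Nil at_Scan c c'
        by (simp add: fun_upd_idem \<open>T i = rm\<close>)
    next
      case (Cons b v3)
      then have "T i = Inp b" using c at_Scan tape_read[of u b v3] by auto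
      then obtain a p' where "(p, a, b, p') \<in> \<Delta>" "s' = to_nat (Scan p')" "t = Inp a" "e = MoveRight"
        using guess_trans_Scan[of p "T i" s' t e] tr c at_Scan markers_not_Inp by auto
      then show ?thesis
        using reachable.at_Scan[OF transduces_snoc[OF at_Scan(2)], of a b p' v v3] Cons at_Scan c c'
          tape_write[of u b v3 a]
        by (simp add: algebra_simps)
    qed
  next
    case (at_Back w1 w2 q)
    show ?thesis
    proof (cases w1 rule: rev_cases)
      case Nil
      then have "T i = lm" using c at_Back tape_left[of w2] by auto
      then have "s' = to_nat (Run (tm_init M))" "t = lm" "e = d"
        using guess_trans_Back[of "T i" s' t e] tr c at_Back markers_not_Inp by auto
      then show ?thesis
        using reachable.at_Run[OF at_Back(2,3) rtranclp.rtrancl_refl] Nil at_Back c c' head_start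
        by (simp add: fun_upd_idem)
    next
      case (snoc w3 a)
      have Ti: "T i = Inp a" using c at_Back snoc tape_read[of w3 a w2] by auto
      then have "s' = to_nat Back" "t = Inp a" "e = MoveLeft"
        using guess_trans_Back[of "T i" s' t e] tr c at_Back markers_not_Inp by auto
      then show ?thesis
        using reachable.at_Back[of w3 "a # w2" v q] snoc at_Back c c' Ti
        by (simp add: fun_upd_idem)
    qed
  next
    case (at_Run w q q' T' i')
    then obtain q'' where "(q', T i, q'', t, e) \<in> tm_trans M" "s' = to_nat (Run q'')"
      using guess_trans_Run[of q' "T i" s' t e] tr c by auto
    then have "tm_step M (q', T, i) (q'', T(i := t), i + move_offset e)"
      by (auto intro: tm_step.intros)
    with at_Run c c' \<open>s' = _\<close> show ?thesis
      by (auto intro!: reachable.at_Run[OF at_Run(2,3)])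
  qed
qed

lemma guess_scan:
  assumes "transduces \<Delta> p w v q"
  shows "(tm_step guess_tm)\<^sup>*\<^sup>* (to_nat (Scan p), tape (u @ v), int (length pre) + int (length u))
    (to_nat (Scan q), tape (u @ w), int (length pre) + int (length u) + int (length w))"
  using assms
proof (induction arbitrary: u)
  case (transduces_Nil p)
  then show ?case by simp
next
  case (transduces_Cons p a b q w v r)
  have "tm_step guess_tm (to_nat (Scan p), tape (u @ b # v), int (length pre) + int (length u))
      (to_nat (Scan q), tape ((u @ [a]) @ v), int (length pre) + int (length (u @ [a])))"
    by (rule guess_step[where t = "Inp a" and e = MoveRight])
      (simp_all add: guess transduces_Cons.hyps(1) tape_write)
  then show ?case
    using transduces_Cons.IH[of "u @ [a]"]
    by (auto intro: converse_rtranclp_into_rtranclp simp: algebra_simps)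
qed

lemma guess_back:
  assumes "w1 \<in> lists A"
  shows "(tm_step guess_tm)\<^sup>*\<^sup>* (to_nat Back, tape (w1 @ w2), int (length pre) + int (length w1) - 1)
    (to_nat Back, tape (w1 @ w2), int (length pre) - 1)"
  using assms
proof (induction w1 arbitrary: w2 rule: rev_induct)
  case Nil
  then show ?case by simp
next
  case (snoc a w1)
  have "tm_step guess_tm
      (to_nat Back, tape (w1 @ a # w2), int (length pre) + int (length w1))
      (to_nat Back, tape (w1 @ a # w2), int (length pre) + int (length w1) - 1)"
    using snoc.prems by (intro guess_step[where t = "Inp a" and e = MoveLeft])
      (simp_all add: retreat tape_write)
  then show ?case
    using snoc.IH[of "a # w2"] snoc.prems by (auto intro: converse_rtranclp_into_rtranclp)
qed

lemma guess_run:
  assumes "(tm_step M)\<^sup>*\<^sup>* (q, T, i) (q', T', i')"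
  shows "(tm_step guess_tm)\<^sup>*\<^sup>* (to_nat (Run q), T, i) (to_nat (Run q'), T', i')"
  using assms
proof (induction "(q', T', i')" arbitrary: q' T' i' rule: rtranclp_induct)
  case base
  then show ?case by simp
next
  case (step c)
  obtain q1 T1 i1 where c: "c = (q1, T1, i1)" by (cases c)
  with step.hyps(2) have "tm_step guess_tm (to_nat (Run q1), T1, i1) (to_nat (Run q'), T', i')"
    by (auto elim!: tm_step.cases intro!: guess_step run)
  with step.hyps(3)[OF c] show ?case by (rule rtranclp.rtrancl_into_rtrancl)
qed

lemma guess_start:
  "(tm_step guess_tm)\<^sup>*\<^sup>* (to_nat start, tape v, 0) (to_nat (Scan p0), tape v, int (length pre))"
proof (cases "start = Start")
  case True
  then have "length pre = 1" using start by auto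
  then have "tm_step guess_tm (to_nat Start, tape v, 0) (to_nat (Scan p0), tape v, 1)"
    using enter tape_left[of v] by (intro guess_step[where t = lm and e = MoveRight])
      (simp_all add: fun_upd_idem)
  then show ?thesis using True \<open>length pre = 1\<close> by simp
next
  case False
  then show ?thesis using start by auto
qed

lemma guess_tm_accepts:
  "tm_accepts guess_tm (pre @ map Inp v @ post) \<longleftrightarrow>
     (\<exists>w. \<exists>q\<in>F. transduces \<Delta> p0 w v q \<and> tm_accepts M (pre @ map Inp w @ post))"
proof
  assume "tm_accepts guess_tm (pre @ map Inp v @ post)"
  then obtain f T i where f: "f \<in> tm_final M"
    and run: "(tm_step guess_tm)\<^sup>*\<^sup>* (to_nat start, tape v, 0) (to_nat (Run f), T, i)"
    by (auto simp: tm_accepts_def tape_def guess_tm_def)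
  have "reachable v (to_nat start, tape v, 0)"
    using start reachable.at_Start[of v] reachable.at_Scan[OF transduces_Nil, of v v] by auto
  with run have "reachable v (to_nat (Run f), T, i)"
    by (induction rule: rtranclp_induct) (auto intro: reachable_step)
  then show "\<exists>w. \<exists>q\<in>F. transduces \<Delta> p0 w v q \<and> tm_accepts M (pre @ map Inp w @ post)"
    using f by cases (auto simp: tm_accepts_def tape_def)
next
  assume "\<exists>w. \<exists>q\<in>F. transduces \<Delta> p0 w v q \<and> tm_accepts M (pre @ map Inp w @ post)"
  then obtain w q f T i where q: "q \<in> F" "transduces \<Delta> p0 w v q" and f: "f \<in> tm_final M"
    and run: "(tm_step M)\<^sup>*\<^sup>* (tm_init M, tape w, 0) (f, T, i)"
    by (auto simp: tm_accepts_def tape_def)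
  note guess_start[of v]
  also have "(tm_step guess_tm)\<^sup>*\<^sup>* (to_nat (Scan p0), tape v, int (length pre))
      (to_nat (Scan q), tape w, int (length pre) + int (length w))"
    using guess_scan[OF q(2), of "[]"] by simp
  also have "tm_step guess_tm (to_nat (Scan q), tape w, int (length pre) + int (length w))
      (to_nat Back, tape w, int (length pre) + int (length w) - 1)"
    using turn[OF q(1)] by (intro guess_step[where t = rm and e = MoveLeft])
      (simp_all add: fun_upd_idem)
  also have "(tm_step guess_tm)\<^sup>*\<^sup>* (to_nat Back, tape w, int (length pre) + int (length w) - 1)
      (to_nat Back, tape w, int (length pre) - 1)"
    using guess_back[of w "[]"] transduces_lists[OF q(2)] by simp
  also have "tm_step guess_tm (to_nat Back, tape w, int (length pre) - 1)
      (to_nat (Run (tm_init M)), tape w, 0)"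
    using launch head_start by (intro guess_step[where t = lm and e = d])
      (simp_all add: fun_upd_idem)
  also note guess_run[OF run]
  finally show "tm_accepts guess_tm (pre @ map Inp v @ post)"
    using f by (auto simp: tm_accepts_def tape_def guess_tm_def)
qed

end

context letter_transducer
begin

lemma tm_transduction:
  assumes "wf_tm A M"
  shows "\<exists>N. wf_tm B N \<and> transduction \<Delta> p0 F (tm_language A M) = tm_language B N"
proof -
  interpret guessing_machine Q A B \<Delta> p0 F M "[]" "[]" Blank Blank MoveRight "Scan p0"
    by unfold_locales (auto simp: tape_of_def)
  have "wf_tm B guess_tm"
    using assms by (intro wf_guess_tm) (auto simp: wf_tm_def)
  moreover have "transduction \<Delta> p0 F (tm_language A M) = tm_language B guess_tm"
    using guess_tm_accepts transduces_lists by (auto simp: transduction_def tm_language_def) blast+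
  ultimately show ?thesis by blast
qed

lemma lba_transduction:
  assumes "wf_lba A M"
  shows "\<exists>N. wf_lba B N \<and> transduction \<Delta> p0 F (lba_language A M) = lba_language B N"
proof -
  interpret guessing_machine Q A B \<Delta> p0 F M "[LEnd]" "[REnd]" LEnd REnd Stay Start
    by unfold_locales (auto simp: tape_of_def nth_append nth_Cons')
  have wf: "wf_tm B guess_tm"
    using assms by (intro wf_guess_tm) (auto simp: wf_lba_def)
  have "t = LEnd \<and> e \<noteq> MoveLeft" if "(q, LEnd, p, t, e) \<in> guess_trans" for q p t e
    using that assms by cases (auto simp: wf_lba_def)
  moreover have "t = REnd \<and> e \<noteq> MoveRight" if "(q, REnd, p, t, e) \<in> guess_trans" for q p t e
    using that assms by cases (auto simp: wf_lba_def)
  ultimately have "wf_lba B guess_tm"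
    using wf assms by (auto simp: wf_lba_def guess_tm_def)
  moreover have "transduction \<Delta> p0 F (lba_language A M) = lba_language B guess_tm"
    using guess_tm_accepts transduces_lists by (auto simp: transduction_def lba_language_def) blast+
  ultimately show ?thesis by blast
qed

end


section \<open>Closure properties shared by the four classes\<close>

context letter_transducer
begin

text \<open>
  The only fact about the Chomsky classes that the passage between groups relies on, apart from
  their containing all words over a finite alphabet.
\<close>
theorem in_class_transduction:
  assumes "in_class C A L"
  shows "in_class C B (transduction \<Delta> p0 F L)"
proof (cases C)
  case Regular
  then show ?thesis using assms wf_fsa_product fsa_language_product by fastforce
next
  case CF
  then show ?thesis using assms wf_pda_product pda_language_product by fastforce
next
  case CS
  then show ?thesis using assms lba_transduction by auto
next
  case RE
  then show ?thesis using assms tm_transduction by auto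
qed

end

text \<open>
  Transductions of this language provide the finite languages that are needed for finite groups.
\<close>
lemma in_class_lists:
  fixes A :: "'a set"
  assumes "finite A"
  shows "in_class C A (lists A)"
proof (cases C)
  case Regular
  define M where "M = \<lparr>fsa_states = {0}, fsa_init = 0, fsa_final = {0}, fsa_trans = {0} \<times> A \<times> {0}\<rparr>"
  have "fsa_run M 0 w 0" if "w \<in> lists A" for w
    using that by induction (auto simp: M_def intro: fsa_run.intros)
  moreover have "w \<in> lists A" if "fsa_run M p w q" for p w q
    using that by induction (auto simp: M_def)
  moreover have "fsa_language M = {w. fsa_run M 0 w 0}" by (auto simp: fsa_language_def M_def)
  ultimately have "fsa_language M = lists A" by blast
  moreover have "wf_fsa A M" by (auto simp: wf_fsa_def M_def)
  ultimately show ?thesis using Regular by auto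
next
  case CF
  define M where "M = \<lparr>pda_states = {0}, pda_stack = {0}, pda_init = 0, pda_bottom = 0, pda_final = {0},
    pda_trans = {0} \<times> Some ` A \<times> {0} \<times> {0} \<times> {[0]}\<rparr>"
  have "(pda_step M)\<^sup>*\<^sup>* (0, w, [0]) (0, [], [0])" if "w \<in> lists A" for w
    using that
  proof induction
    case (Cons a w)
    then have "pda_step M (0, a # w, [0]) (0, w, [0])"
      using pda_step_read[of 0 a 0 0 "[0]" M w "[]"] by (auto simp: M_def)
    with Cons.IH show ?case by (rule converse_rtranclp_into_rtranclp[rotated])
  qed auto
  moreover have "w \<in> lists A" if "(pda_step M)\<^sup>*\<^sup>* (p, w, \<beta>) (f, [], \<beta>')" for p w f \<beta> \<beta>'
    using that
    by (induction "(p, w, \<beta>)" arbitrary: p w \<beta> rule: converse_rtranclp_induct)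
      (auto elim!: pda_step.cases simp: M_def)
  moreover have "pda_language M = {w. \<exists>\<beta>. (pda_step M)\<^sup>*\<^sup>* (0, w, [0]) (0, [], \<beta>)}"
    by (auto simp: pda_language_def M_def)
  ultimately have "pda_language M = lists A" by blast
  moreover have "wf_pda A M" using assms by (auto simp: wf_pda_def M_def)
  ultimately show ?thesis using CF by auto
next
  case CS
  define M :: "'a tm" where "M = \<lparr>tm_states = {0}, tm_syms = Inp ` A \<union> {Blank, LEnd, REnd}, tm_init = 0, tm_final = {0},
    tm_trans = {}\<rparr>"
  have "lba_language A M = lists A" by (auto simp: lba_language_def tm_accepts_def M_def)
  moreover have "wf_lba A M" using assms by (auto simp: wf_lba_def wf_tm_def M_def)
  ultimately show ?thesis using CS by auto
next
  case RE
  define M :: "'a tm" where "M = \<lparr>tm_states = {0}, tm_syms = Inp ` A \<union> {Blank}, tm_init = 0, tm_final = {0},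
    tm_trans = {}\<rparr>"
  have "tm_language A M = lists A" by (auto simp: tm_language_def tm_accepts_def M_def)
  moreover have "wf_tm A M" using assms by (auto simp: wf_tm_def M_def)
  ultimately show ?thesis using RE by auto
qed

section \<open>Word values and transversals\<close>

lemma word_value_Nil [simp]: "word_value G [] = \<one>\<^bsub>G\<^esub>"
  by (simp add: word_value_def)

lemma word_value_Cons [simp]: "word_value G (a # w) = a \<otimes>\<^bsub>G\<^esub> word_value G w"
  by (simp add: word_value_def)

lemma word_value_subgroup [simp]: "word_value (G\<lparr>carrier := H\<rparr>) w = word_value G w"
  by (simp add: word_value_def)

lemma (in group) word_value_closed: "w \<in> lists H \<Longrightarrow> subgroup H G \<Longrightarrow> word_value G w \<in> H"
  by (induction w) (auto simp: subgroup.one_closed subgroup.m_closed)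

lemma (in group) word_value_snoc:
  "w \<in> lists (carrier G) \<Longrightarrow> a \<in> carrier G \<Longrightarrow> word_value G (w @ [a]) = word_value G w \<otimes> a"
  by (induction w) (auto simp: m_assoc word_value_closed subgroup_self)

text \<open>
  A language that represents exactly the nontrivial elements uses a generating alphabet, because
  the empty word represents \<open>1\<close>.
\<close>
lemma epi_groupI:
  assumes "finite X" and "X \<subseteq> carrier G" and "L \<subseteq> lists X" and "in_class C X L"
    and "\<And>w. w \<in> L \<Longrightarrow> word_value G w \<noteq> \<one>\<^bsub>G\<^esub>"
    and cover: "\<And>g. g \<in> carrier G \<Longrightarrow> g \<noteq> \<one>\<^bsub>G\<^esub> \<Longrightarrow> \<exists>w\<in>L. word_value G w = g"
  shows "epi_group C G"
proof -
  have "\<exists>w\<in>lists X. word_value G w = g" if "g \<in> carrier G" for g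
    using cover[OF that] \<open>L \<subseteq> lists X\<close> by (cases "g = \<one>\<^bsub>G\<^esub>") (auto intro: bexI[of _ "[]"])
  then have "generates_as_monoid G X"
    using assms(2) by (auto simp: generates_as_monoid_def)
  then show ?thesis
    using assms unfolding epi_group_def by blast
qed

text \<open>
  The representative of the coset \<open>H\<close> is chosen to be \<open>1\<close>. That no other representative lies in
  \<open>H\<close> makes returning to the coset \<open>H\<close> the same as returning to the state \<open>1\<close>.
\<close>
lemma (in group) right_transversal:
  assumes H: "subgroup H G" and fin: "finite (rcosets H)"
  obtains T where "finite T" and "T \<subseteq> carrier G" and "\<one> \<in> T" and "T \<inter> H = {\<one>}"
    and "\<And>g. g \<in> carrier G \<Longrightarrow> \<exists>t\<in>T. g \<otimes> inv t \<in> H"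
proof
  define rep where "rep K = (SOME g. g \<in> K)" for K :: "'a set"
  define T where "T = insert \<one> (rep ` (rcosets H - {H}))"
  have rep: "rep (H #> g) \<in> H #> g" if "g \<in> carrier G" for g
    unfolding rep_def using rcos_self[OF that H] by (rule someI)
  have Hsub: "H \<subseteq> carrier G" by (rule subgroup.subset[OF H])
  show "finite T" using fin by (simp add: T_def)
  show "T \<subseteq> carrier G"
    using rep r_coset_subset_G[OF Hsub] by (fastforce simp: T_def RCOSETS_def)
  show "\<one> \<in> T" by (simp add: T_def)
  have "rep (H #> g) \<notin> H" if "g \<in> carrier G" "H #> g \<noteq> H" for g
    using that rep[OF that(1)] repr_independence[OF _ that(1) H] coset_join2[OF _ H] Hsub by blast
  then show "T \<inter> H = {\<one>}"
    using subgroup.one_closed[OF H] by (auto simp: T_def RCOSETS_def)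
  show "\<exists>t\<in>T. g \<otimes> inv t \<in> H" if g: "g \<in> carrier G" for g
  proof (cases "H #> g = H")
    case True
    then have "g \<in> H" using rcos_self[OF g H] by simp
    then show ?thesis using g by (intro bexI[of _ \<one>]) (auto simp: T_def)
  next
    case False
    obtain h where h: "h \<in> H" "rep (H #> g) = h \<otimes> g"
      using rep[OF g] by (auto simp: r_coset_def)
    then have "g \<otimes> inv (rep (H #> g)) = inv h"
      using g Hsub by (auto simp: inv_mult_group m_assoc[symmetric])
    then have "g \<otimes> inv (rep (H #> g)) \<in> H"
      using h H by (simp add: subgroup.m_inv_closed)
    moreover have "rep (H #> g) \<in> T"
      using False g by (auto simp: T_def RCOSETS_def)
    ultimately show ?thesis by blast
  qed
qed


section \<open>Passing to a subgroup\<close>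

text \<open>
  Reidemeister--Schreier rewriting. The representatives are numbered as \<open>r 0, \<dots>, r (n - 1)\<close> with
  \<open>r k = 1\<close>, and a transition from \<open>i\<close> to \<open>j\<close> outputs \<open>r i \<otimes> x \<otimes> inv (r j)\<close> provided that this lies
  in \<open>H\<close>, that is, provided that \<open>r j\<close> represents the coset of \<open>r i \<otimes> x\<close>. Along a run these
  outputs telescope (\<open>run_value\<close>).
\<close>
lemma (in group) epi_group_subgroup:
  assumes H: "subgroup H G" and fin: "finite (rcosets H)" and epi: "epi_group C G"
  shows "epi_group C (G\<lparr>carrier := H\<rparr>)"
proof -
  obtain T where T: "finite T" "T \<subseteq> carrier G" "\<one> \<in> T" "T \<inter> H = {\<one>}"
    and T_cover: "\<And>g. g \<in> carrier G \<Longrightarrow> \<exists>t\<in>T. g \<otimes> inv t \<in> H"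
    using right_transversal[OF H fin] by metis
  obtain X L where X: "finite X" "X \<subseteq> carrier G" and L: "L \<subseteq> lists X" "in_class C X L"
    and L_ne: "\<And>w. w \<in> L \<Longrightarrow> word_value G w \<noteq> \<one>"
    and L_cover: "\<And>g. g \<in> carrier G \<Longrightarrow> g \<noteq> \<one> \<Longrightarrow> \<exists>w\<in>L. word_value G w = g"
    using epi unfolding epi_group_def generates_as_monoid_def by auto
  have Hsub: "H \<subseteq> carrier G" by (rule subgroup.subset[OF H])
  obtain r and n :: nat where r: "bij_betw r {..<n} T"
    using ex_bij_betw_nat_finite[OF T(1)] by (auto simp: atLeast0LessThan)
  then have r_closed: "r i \<in> carrier G" if "i < n" for i
    using that T(2) by (auto dest: bij_betwE)
  obtain k where k: "k < n" "r k = \<one>"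
    using r T(3) by (auto simp: bij_betw_def)
  have r_H: "j = k" if "j < n" "r j \<in> H" for j
  proof -
    have "r j = r k" using that T(4) r k by (auto dest: bij_betwE)
    then show ?thesis using that(1) k(1) r by (auto simp: bij_betw_def inj_on_def)
  qed
  define \<Delta> where "\<Delta> = {(i, x, y, j). i < n \<and> j < n \<and> x \<in> X \<and> y = r i \<otimes> x \<otimes> inv (r j) \<and> y \<in> H}"
  define Y where "Y = (\<Union>i<n. \<Union>x\<in>X. \<Union>j<n. {r i \<otimes> x \<otimes> inv (r j)}) \<inter> H"
  interpret letter_transducer "{..<n}" X Y \<Delta> k "{k}"
    by unfold_locales (use X(1) k in \<open>auto simp: \<Delta>_def Y_def\<close>)
  have run_value: "word_value G v = r i \<otimes> word_value G u \<otimes> inv (r j) \<and> j < n"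
    if "transduces \<Delta> i u v j" "i < n" for i u v j
    using that
  proof induction
    case (transduces_Nil i)
    then show ?case using r_closed by simp
  next
    case (transduces_Cons i x y j u v l)
    then have ij: "j < n" "x \<in> carrier G" "y = r i \<otimes> x \<otimes> inv (r j)" "l < n"
      and v: "word_value G v = r j \<otimes> word_value G u \<otimes> inv (r l)"
      using X(2) by (auto simp: \<Delta>_def)
    have u: "word_value G u \<in> carrier G"
      using transduces_lists[OF transduces_Cons.hyps(2)] X(2)
      by (auto intro!: word_value_closed subgroup_self)
    have "inv (r j) \<otimes> (r j \<otimes> z) = z" if "z \<in> carrier G" for z
      using that ij(1) r_closed by (simp add: m_assoc[symmetric])
    then show ?case
      using ij u r_closed \<open>i < n\<close> by (simp add: v m_assoc)
  qed
  have run: "\<exists>v j. transduces \<Delta> i u v j" if "u \<in> lists X" "i < n" for u i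
    using that
  proof (induction u arbitrary: i)
    case Nil
    then show ?case by (auto intro: transduces.intros)
  next
    case (Cons x u)
    then have x: "x \<in> carrier G" using X(2) by auto
    obtain t where "t \<in> T" "r i \<otimes> x \<otimes> inv t \<in> H"
      using T_cover[of "r i \<otimes> x"] x r_closed Cons.prems by auto
    then obtain j where j: "j < n" "r i \<otimes> x \<otimes> inv (r j) \<in> H"
      using r by (auto simp: bij_betw_def)
    then have "(i, x, r i \<otimes> x \<otimes> inv (r j), j) \<in> \<Delta>"
      using Cons by (auto simp: \<Delta>_def)
    moreover obtain v l where "transduces \<Delta> j u v l"
      using Cons.IH[of j] Cons.prems j by auto
    ultimately show ?case by (blast intro: transduces.intros)
  qed
  show ?thesis
  proof (rule epi_groupI)
    show "finite Y" "Y \<subseteq> carrier (G\<lparr>carrier := H\<rparr>)"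
      using X(1) by (auto simp: Y_def)
    show "transduction \<Delta> k {k} L \<subseteq> lists Y" by (rule transduction_subset)
    show "in_class C Y (transduction \<Delta> k {k} L)" by (rule in_class_transduction[OF L(2)])
    show "word_value (G\<lparr>carrier := H\<rparr>) v \<noteq> \<one>\<^bsub>G\<lparr>carrier := H\<rparr>\<^esub>" if "v \<in> transduction \<Delta> k {k} L" for v
    proof -
      obtain u where u: "u \<in> L" "transduces \<Delta> k u v k"
        using \<open>v \<in> _\<close> by (auto simp: transduction_def)
      have "word_value G u \<in> carrier G"
        using u(1) L(1) X(2) by (auto intro!: word_value_closed subgroup_self)
      then have "word_value G v = word_value G u"
        using run_value[OF u(2)] k by simp
      then show ?thesis using L_ne[OF u(1)] by simp
    qed
    show "\<exists>v\<in>transduction \<Delta> k {k} L. word_value (G\<lparr>carrier := H\<rparr>) v = h"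
      if "h \<in> carrier (G\<lparr>carrier := H\<rparr>)" "h \<noteq> \<one>\<^bsub>G\<lparr>carrier := H\<rparr>\<^esub>" for h
    proof -
      have h: "h \<in> H" "h \<in> carrier G" "h \<noteq> \<one>" using that Hsub by auto
      obtain u where u: "u \<in> L" "word_value G u = h"
        using L_cover[of h] h by blast
      obtain v j where v: "transduces \<Delta> k u v j"
        using run[of u k] u(1) L(1) k by auto
      have j: "word_value G v = h \<otimes> inv (r j)" "j < n"
        using run_value[OF v k(1)] u k h by auto
      have "word_value G v \<in> H"
        using transduces_lists[OF v] by (auto intro!: word_value_closed[OF _ H] simp: Y_def)
      \<comment> \<open>Since \<open>v\<close> has value \<open>h \<otimes> inv (r j)\<close>, the element below is \<open>r j\<close>: the run ends in the coset \<open>H\<close>.\<close>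
      then have "inv (inv h \<otimes> word_value G v) \<in> H"
        using h(1) H by (simp add: subgroup.m_closed subgroup.m_inv_closed)
      then have "r j \<in> H"
        using j h(2) r_closed by (simp add: m_assoc[symmetric])
      then have "j = k" using r_H j(2) by blast
      then have "v \<in> transduction \<Delta> k {k} L" "word_value G v = h"
        using u(1) v j k h by (auto simp: transduction_def)
      then show ?thesis by auto
    qed
  qed
qed


section \<open>Passing to an overgroup\<close>

text \<open>
  The transducer turns the language of all words over the nontrivial elements into the language of
  the one-letter words, which has no word of value \<open>1\<close>.
\<close>
lemma (in group) epi_group_finite:
  assumes "finite (carrier G)"
  shows "epi_group C G"
proof -
  define X where "X = carrier G - {\<one>}"
  define \<Delta> :: "(nat \<times> 'a \<times> 'a \<times> nat) set" where "\<Delta> = {(0, x, x, 1) | x. x \<in> X}"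
  interpret letter_transducer "{0, 1}" X X \<Delta> 0 "{1}"
    by unfold_locales (use assms in \<open>auto simp: \<Delta>_def X_def\<close>)
  define L where "L = transduction \<Delta> 0 {1} (lists X)"
  have "v \<in> L \<longleftrightarrow> (\<exists>x\<in>X. v = [x])" for v
  proof
    assume "v \<in> L"
    then obtain u where "transduces \<Delta> 0 u v 1" by (auto simp: L_def transduction_def)
    then show "\<exists>x\<in>X. v = [x]"
    proof cases
      case (transduces_Cons x y q u' v')
      then have "x \<in> X" "y = x" "q = 1" by (auto simp: \<Delta>_def)
      moreover have "v' = []"
        using transduces_Cons(4) \<open>q = 1\<close> by cases (auto simp: \<Delta>_def)
      ultimately show ?thesis using transduces_Cons by auto
    qed simp
  next
    assume "\<exists>x\<in>X. v = [x]"
    then obtain x where x: "x \<in> X" "v = [x]" by blast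
    then have "transduces \<Delta> 0 [x] v 1"
      by (auto simp: \<Delta>_def intro: transduces.intros)
    then show "v \<in> L" using x by (auto simp: L_def transduction_def)
  qed
  then have L: "L = (\<lambda>x. [x]) ` X" by auto
  have "in_class C X L"
    unfolding L_def using in_class_lists[OF finite_A] by (rule in_class_transduction)
  then show ?thesis
    by (rule epi_groupI[rotated 3]) (use assms in \<open>auto simp: L X_def\<close>)
qed

text \<open>
  The transducer copies a word of \<open>L\<close> in state \<open>0\<close> and enters the final state \<open>1\<close>, which has no
  way out, with the last letter, which it multiplies by an element of \<open>S\<close>. The only
  element of \<open>S\<close> in \<open>H\<close> is \<open>1\<close>, so that no word of value \<open>1\<close> arises: the extra factor would be
  inverse to an element of \<open>H\<close>, hence \<open>1\<close>, and the original word would have had value \<open>1\<close>.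
\<close>
lemma (in group) epi_group_overgroup:
  assumes H: "subgroup H G" and fin: "finite (rcosets H)" and epi: "epi_group C (G\<lparr>carrier := H\<rparr>)"
  shows "epi_group C G"
proof -
  obtain T where T: "finite T" "T \<subseteq> carrier G" "\<one> \<in> T" "T \<inter> H = {\<one>}"
    and T_cover: "\<And>g. g \<in> carrier G \<Longrightarrow> \<exists>t\<in>T. g \<otimes> inv t \<in> H"
    using right_transversal[OF H fin] by metis
  have Hsub: "H \<subseteq> carrier G" by (rule subgroup.subset[OF H])
  show ?thesis
  proof (cases "H = {\<one>}")
    case True
    have "carrier G \<subseteq> T"
    proof
      fix g assume g: "g \<in> carrier G"
      then obtain t where t: "t \<in> T" "g \<otimes> inv t = \<one>" using T_cover True by auto
      then have "inv (inv t) = g" using g T(2) by (intro inv_equality) auto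
      then show "g \<in> T" using t T(2) by auto
    qed
    then show ?thesis using T(1) by (auto intro: epi_group_finite finite_subset)
  next
    case False
    then obtain k where k: "k \<in> H" "k \<noteq> \<one>" using subgroup.one_closed[OF H] by blast
    obtain X L where X: "finite X" "X \<subseteq> H" and L: "L \<subseteq> lists X" "in_class C X L"
      and L_ne: "\<And>w. w \<in> L \<Longrightarrow> word_value G w \<noteq> \<one>"
      and L_cover: "\<And>h. h \<in> H \<Longrightarrow> h \<noteq> \<one> \<Longrightarrow> \<exists>w\<in>L. word_value G w = h"
      using epi unfolding epi_group_def generates_as_monoid_def by auto
    define S where "S = insert \<one> ((T - H) \<union> (\<lambda>t. k \<otimes> t) ` (T - H))"
    have S: "finite S" "S \<subseteq> carrier G"
      using T(1,2) k Hsub by (auto simp: S_def)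
    have S_H: "s = \<one>" if "s \<in> S" "s \<in> H" for s
    proof (rule ccontr)
      assume "s \<noteq> \<one>"
      with that obtain t where t: "t \<in> T - H" "s = k \<otimes> t" by (auto simp: S_def)
      moreover have "t \<in> carrier G" "k \<in> carrier G" using t k(1) T(2) Hsub by auto
      ultimately have "t = inv k \<otimes> s" by (simp add: m_assoc[symmetric])
      moreover have "inv k \<otimes> s \<in> H"
        using that(2) k(1) H by (simp add: subgroup.m_closed subgroup.m_inv_closed)
      ultimately show False using t(1) by auto
    qed
    define \<Delta> :: "(nat \<times> 'a \<times> 'a \<times> nat) set"
      where "\<Delta> = {(0, x, x, 0) | x. x \<in> X} \<union> {(0, x, x \<otimes> s, 1) | x s. x \<in> X \<and> s \<in> S}"
    define Y where "Y = X \<union> (\<lambda>(x, s). x \<otimes> s) ` (X \<times> S)"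
    interpret letter_transducer "{0, 1}" X Y \<Delta> 0 "{1}"
      by unfold_locales (use X(1) S(1) in \<open>auto simp: \<Delta>_def Y_def\<close>)
    define L' where "L' = transduction \<Delta> 0 {1} L"
    have sound: "\<exists>w\<in>L. \<exists>s\<in>S. word_value G v = word_value G w \<otimes> s" if "v \<in> L'" for v
    proof -
      have final: "transduces \<Delta> 1 u v q \<Longrightarrow> u = [] \<and> v = []" for u v q
        by (auto elim: transduces.cases simp: \<Delta>_def)
      have "\<exists>s\<in>S. word_value G v = word_value G u \<otimes> s" if "transduces \<Delta> 0 u v 1" for u v
        using that
      proof (induction "0::nat" u v "1::nat" rule: transduces.induct)
        case (transduces_Cons x y q u v)
        have u: "word_value G u \<in> carrier G"
          using transduces_lists[OF transduces_Cons.hyps(2)] X(2) Hsub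
          by (auto intro!: word_value_closed subgroup_self)
        from transduces_Cons.hyps(1) consider "q = 0" "y = x" "x \<in> X"
          | s where "q = 1" "y = x \<otimes> s" "x \<in> X" "s \<in> S"
          by (auto simp: \<Delta>_def)
        then show ?case
        proof cases
          case 1
          then obtain s where "s \<in> S" "word_value G v = word_value G u \<otimes> s"
            using transduces_Cons.hyps(3) by auto
          moreover from this have "x \<otimes> (word_value G u \<otimes> s) = x \<otimes> word_value G u \<otimes> s"
            using 1 X(2) Hsub S(2) u by (intro m_assoc[symmetric]) auto
          ultimately show ?thesis using 1 by auto
        next
          case 2
          moreover from this have "x \<in> carrier G" "s \<in> carrier G"
            using X(2) Hsub S(2) by auto
          ultimately show ?thesis
            using final[of u v 1] transduces_Cons.hyps(2) by (intro bexI[of _ s]) auto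
        qed
      qed simp
      with \<open>v \<in> L'\<close> show ?thesis by (fastforce simp: L'_def transduction_def)
    qed
    have complete: "\<exists>v\<in>L'. word_value G v = word_value G w \<otimes> s" if "w \<in> L" "s \<in> S" for w s
    proof -
      have copy: "transduces \<Delta> 0 u u 0" if "u \<in> lists X" for u
        using that by induction (auto simp: \<Delta>_def intro: transduces.intros)
      have "w \<noteq> []" using L_ne[OF that(1)] by auto
      then obtain u x where ux: "w = u @ [x]" by (cases w rule: rev_cases) auto
      then have X_ux: "u \<in> lists X" "x \<in> X" using that(1) L(1) by auto
      then have G_ux: "u \<in> lists (carrier G)" "x \<in> carrier G" "s \<in> carrier G"
        using X(2) Hsub S(2) that(2) by auto
      have "transduces \<Delta> 0 w (u @ [x \<otimes> s]) 1"
        unfolding ux using X_ux that(2) by (intro transduces_snoc[OF copy]) (auto simp: \<Delta>_def)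
      then have "u @ [x \<otimes> s] \<in> L'" using that(1) by (auto simp: L'_def transduction_def)
      moreover have "word_value G (u @ [x \<otimes> s]) = word_value G w \<otimes> s"
        using G_ux by (simp add: ux word_value_snoc m_assoc word_value_closed subgroup_self)
      ultimately show ?thesis by blast
    qed
    have L_H: "word_value G w \<in> H" if "w \<in> L" for w
      using that L(1) X(2) by (auto intro!: word_value_closed[OF _ H])
    show ?thesis
    proof (rule epi_groupI)
      show "finite Y" by (rule finite_B)
      show "Y \<subseteq> carrier G" using X(2) Hsub S(2) by (auto simp: Y_def)
      show "L' \<subseteq> lists Y" unfolding L'_def by (rule transduction_subset)
      show "in_class C Y L'" unfolding L'_def by (rule in_class_transduction[OF L(2)])
      show "word_value G v \<noteq> \<one>" if "v \<in> L'" for v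
      proof
        assume "word_value G v = \<one>"
        with sound[OF that] obtain w s where ws: "w \<in> L" "s \<in> S" "word_value G w \<otimes> s = \<one>"
          by metis
        then have "s = inv (word_value G w)"
          using L_H Hsub S(2) by (metis inv_equality inv_inv subsetD)
        then have "s = \<one>"
          using S_H ws L_H H by (metis subgroup.m_inv_closed)
        then show False using ws L_ne L_H Hsub by (metis r_one subsetD)
      qed
      show "\<exists>v\<in>L'. word_value G v = g" if g: "g \<in> carrier G" "g \<noteq> \<one>" for g
      proof -
        obtain t where t: "t \<in> T" "g \<otimes> inv t \<in> H" using T_cover g by blast
        define h where "h = g \<otimes> inv t"
        have tG: "t \<in> carrier G" using t T(2) by auto
        have h: "h \<in> H" "h \<in> carrier G" "g = h \<otimes> t"
          using t g tG Hsub by (auto simp: h_def m_assoc)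
        have "\<exists>h'\<in>H - {\<one>}. \<exists>s\<in>S. g = h' \<otimes> s"
        proof (cases "t \<in> H")
          case True
          then have "t = \<one>" using t T(4) by auto
          then have "h \<in> H - {\<one>}" "\<one> \<in> S" "g = h \<otimes> \<one>" using h g by (auto simp: S_def)
          then show ?thesis by blast
        next
          case tH: False
          show ?thesis
          proof (cases "h = \<one>")
            case True
            have "g = inv k \<otimes> (k \<otimes> t)"
              using True h tG k(1) Hsub by (auto simp: m_assoc[symmetric])
            moreover have "inv k \<in> H - {\<one>}"
              using k H Hsub by (auto simp: subgroup.m_inv_closed)
            moreover have "k \<otimes> t \<in> S" using t tH by (auto simp: S_def)
            ultimately show ?thesis by blast
          next
            case False
            then have "h \<in> H - {\<one>}" "t \<in> S" using h t tH by (auto simp: S_def)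
            then show ?thesis using h(3) by blast
          qed
        qed
        then obtain h' s where "h' \<in> H" "h' \<noteq> \<one>" "s \<in> S" "g = h' \<otimes> s" by blast
        then show ?thesis using L_cover complete by metis
      qed
    qed
  qed
qed

theorem theoremD:
  fixes C :: chomsky_class
    and G :: "('a, 'b) monoid_scheme"
    and H :: "'a set"
  assumes "group G"
    and "subgroup H G"
    and "finite (rcosets\<^bsub>G\<^esub> H)"
  shows "(epi_group C G \<longrightarrow> epi_group C (G\<lparr>carrier := H\<rparr>)) \<and> (epi_group C (G\<lparr>carrier := H\<rparr>) \<longrightarrow> epi_group C G)"
  using group.epi_group_subgroup[OF assms] group.epi_group_overgroup[OF assms] by blast

end
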